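(* Assume that $K$ is a self-similar set with SSC, and that $f\in L^1(K,\mu)$ and $M_{\mathcal{D}}^\mu f\in L^1(K,\mu)$. Then $|f|\log^+|f|\in L^1(K,\mu)$ and there exists a positive constant $C$ such that $$\int_K |f(x)|\log^+|f(x)|\, d\mu(x)\le C\int_K M_{\mathcal{D}}^\mu f(x)\, d\mu(x).$$
   Context: Self-similar set and measure. For $1\le i\le m$ let $S_i:\mathbb{R}^d\to\mathbb{R}^d$, $S_i(x)=r_iR_i(x)+b_i$ with $0<r_i<1$, $b_i\in\mathbb{R}^d$, $R_i$ orthogonal. $K\subset\mathbb{R}^d$ is the unique nonempty compact set with $K=\bigcup_{i=1}^m S_i(K)$ (the self-similar set generated by $\{S_i\}_{i=1}^m$). It is always assumed that the $S_i$ do not all share a common fixed point. Given a probability vector $(p_1,\dots,p_m)$ with all $p_i>0$ and $\sum_i p_i=1$, $\mu$ is the unique Borel probability measure with $\mu=\sum_{i=1}^m p_i\,\mu\circ S_i^{-1}$ (self-similar measure; it is supported on $K$). Strong separation condition (SSC): $S_i(K)\cap S_j(K)=\emptyset$ for all $i\ne j$. Basic cubes. $\Sigma_n=\{1,\dots,m\}^n$ for $n\ge1$. For $\mathbf{i}=i_1\ldots i_n$, $S_{\mathbf{i}}=S_{i_1}\circ\cdots\circ S_{i_n}$ and $K_{\mathbf{i}}=S_{\mathbf{i}}(K)$. $\mathcal{D}$ is the collection consisting of $K$ and all $K_{\mathbf{i}}$, $\mathbf{i}\in\Sigma_n$, $n\ge1$ (basic cubes). Maximal operator. $M_{\mathcal{D}}^\mu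 f(x)=\sup\frac{1}{\mu(K_{\mathbf{i}})}\int_{K_{\mathbf{i}}}|f|\,d\mu$ for $x\in K$, the supremum being over all $n\in\mathbb{N}=\{1,2,\dots\}$ and all $\mathbf{i}\in\Sigma_n$ with $x\in K_{\mathbf{i}}$. $\log^+t:=\max\{0,\log t\}$ for $t>0$, and $|f|\log^+|f|$ is $0$ where $f=0$. *)

theory Defs
  imports "HOL-Analysis.Analysis" "HOL-Probability.Probability"
begin

definition self_similar_set ::
  "nat \<Rightarrow> (nat \<Rightarrow> 'a::euclidean_space \<Rightarrow> 'a) \<Rightarrow> 'a set \<Rightarrow> bool" where
  "self_similar_set m S K \<longleftrightarrow>
     compact K \<and> K \<noteq> {} \<and> K = (\<Union>i\<in>{1..m}. S i ` K)"

definition self_similar_measure ::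
  "nat \<Rightarrow> (nat \<Rightarrow> 'a::euclidean_space \<Rightarrow> 'a) \<Rightarrow> (nat \<Rightarrow> real) \<Rightarrow> 'a measure \<Rightarrow> bool" where
  "self_similar_measure m S p \<mu> \<longleftrightarrow>
     prob_space \<mu> \<and> sets \<mu> = sets borel \<and>
     (\<forall>A\<in>sets borel.
        emeasure \<mu> A = (\<Sum>i\<in>{1..m}. ennreal (p i) * emeasure \<mu> (S i -` A)))"

definition strong_separation ::
  "nat \<Rightarrow> (nat \<Rightarrow> 'a \<Rightarrow> 'a) \<Rightarrow> 'a set \<Rightarrow> bool" where
  "strong_separation m S K \<longleftrightarrow>
     (\<forall>i\<in>{1..m}. \<forall>j\<in>{1..m}. i \<noteq> j \<longrightarrow> S i ` K \<inter> S j ` K = {})"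

definition words :: "nat \<Rightarrow> nat \<Rightarrow> nat list set" where
  "words m n = {w. length w = n \<and> set w \<subseteq> {1..m}}"

text \<open>For a word \<open>w = [i\<^sub>1, \<dots>, i\<^sub>n]\<close> this is \<open>(S i\<^sub>1 \<circ> \<dots> \<circ> S i\<^sub>n) ` K\<close>.\<close>
definition basic_cube :: "(nat \<Rightarrow> 'a \<Rightarrow> 'a) \<Rightarrow> 'a set \<Rightarrow> nat list \<Rightarrow> 'a set" where
  "basic_cube S K w = foldr (\<lambda>i g. S i \<circ> g) w id ` K"

text \<open>The supremum may be infinite, so it is taken in \<^typ>\<open>ennreal\<close>. Only words of length
  at least one occur, i.e. \<open>K\<close> itself is not among the averaging sets.\<close>
definition maximal_op ::
  "nat \<Rightarrow> (nat \<Rightarrow> 'a \<Rightarrow> 'a) \<Rightarrow> 'a set \<Rightarrow> 'a measure \<Rightarrow> ('a \<Rightarrow> real) \<Rightarrow> 'a \<Rightarrow> ennreal" where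
  "maximal_op m S K \<mu> f x =
     (SUP w \<in> {w \<in> (\<Union>n\<in>{1..}. words m n). x \<in> basic_cube S K w}.
        (\<integral>\<^sup>+y\<in>basic_cube S K w. ennreal \<bar>f y\<bar> \<partial>\<mu>) / emeasure \<mu> (basic_cube S K w))"

text \<open>Membership in \<open>L\<^sup>1(A, M)\<close> for functions with values in \<open>[0, \<infinity>]\<close>, for which
  \<^const>\<open>set_integrable\<close> is not available.\<close>
definition set_L1_ennreal :: "'a measure \<Rightarrow> 'a set \<Rightarrow> ('a \<Rightarrow> ennreal) \<Rightarrow> bool" where
  "set_L1_ennreal M A g \<longleftrightarrow>
     (\<lambda>x. g x * indicator A x) \<in> borel_measurable M \<and> (\<integral>\<^sup>+x\<in>A. g x \<partial>M) < \<infinity>"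

definition log_plus :: "real \<Rightarrow> real" where
  "log_plus t = max 0 (ln t)"

end

theory Submission
  imports Defs
begin

text \<open>
  By separation, the basic cubes of level \<open>n\<close> partition \<open>K\<close>, the partitions refine each other,
  and a child has at least the fraction \<open>c = min p\<^sub>i\<close> of the mass of its parent. Let \<open>g = \<bar>f\<bar>\<close> on
  \<open>K\<close> and \<open>0\<close> elsewhere, and let \<open>g\<^sub>n\<close> be the average of \<open>g\<close> over the cube of level \<open>n\<close> around
  the point. Since a child is not much lighter than its parent, \<open>g\<^sub>n\<^sub>+\<^sub>1 \<le> g\<^sub>n / c\<close>: averages cannot
  jump up by more than a bounded factor. This is what makes the converse of the maximal theorem true.

  Fix \<open>l \<ge> max 1 (\<integral>g)\<close> and let \<open>N\<^sub>n = max (l, g\<^sub>1, \<dots>, g\<^sub>n)\<close>, which is constant on cubes of level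
  \<open>n\<close>. Where \<open>N\<^sub>n\<^sub>+\<^sub>1 > N\<^sub>n\<close> one has \<open>N\<^sub>n\<^sub>+\<^sub>1 = g\<^sub>n\<^sub>+\<^sub>1 \<le> N\<^sub>n / c\<close>, so that \<open>ln t - ln s \<le> (t - s) / s\<close> gives
  \<open>g\<^sub>n\<^sub>+\<^sub>1 (ln N\<^sub>n\<^sub>+\<^sub>1 - ln N\<^sub>n) \<le> (N\<^sub>n\<^sub>+\<^sub>1 - N\<^sub>n) / c\<close> (lemma \<open>log_increment\<close>). Integrating, one may
  replace \<open>g\<^sub>n\<^sub>+\<^sub>1\<close> by \<open>g\<close> on the left because the logarithms are constant on cubes of level \<open>n + 1\<close>;
  then the sum over \<open>n\<close> telescopes on both sides (lemma \<open>integral_log_running_max\<close>):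
  \<open>\<integral> g ln N\<^sub>n \<le> (\<integral> g) ln l + (\<integral> (N\<^sub>n - l)) / c\<close>.
  This replaces the usual decomposition of the level sets of the maximal function into maximal
  cubes followed by an integration over the levels.

  Here \<open>N\<^sub>n - l\<close> is at most the maximal function, and \<open>g\<close> is at most the maximal function almost
  everywhere (lemma \<open>AE_le_maximal\<close>). The latter bounds \<open>\<integral> g\<close>, and it also shows that
  \<open>sup\<^sub>n N\<^sub>n \<ge> g\<close>, so monotone convergence yields the theorem with \<open>C = ln l + 1 / c\<close>. The constant has
  to depend on \<open>f\<close> through \<open>l\<close>: for a large constant \<open>f\<close> the left side is \<open>f ln f\<close> and the maximal
  function is \<open>f\<close>.

  On the geometric side one has to see that \<open>\<mu>\<close> is carried by \<open>K\<close> (lemma \<open>AE_in_K\<close>), whence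
  \<open>\<mu>(S\<^sub>i(B)) = p\<^sub>i \<mu>(B)\<close> for compact \<open>B \<subseteq> K\<close> (lemma \<open>emeasure_image_S\<close>) and the mass of a cube is the
  product of the weights along its word.
\<close>

section \<open>Averages over nested partitions\<close>

text \<open>The features of the basic cubes that the inequality depends on. The condition on open sets says
  that the cells shrink to points, so that the averages of a function over them recover the function.\<close>

locale nested_partitions = prob_space M for M :: "'a::polish_space measure" +
  fixes P :: "nat \<Rightarrow> 'a set set" and K :: "'a set" and c :: real
  assumes sets_eq_borel: "sets M = sets borel"
    and cells_0: "P 0 = {K}"
    and finite_cells: "finite (P n)"
    and cell_borel: "A \<in> P n \<Longrightarrow> A \<in> sets M"
    and cells_disjoint: "A \<in> P n \<Longrightarrow> B \<in> P n \<Longrightarrow> x \<in> A \<Longrightarrow> x \<in> B \<Longrightarrow> A = B"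
    and cells_cover: "\<Union>(P n) = K"
    and parent_cell: "A \<in> P (Suc n) \<Longrightarrow> \<exists>B\<in>P n. A \<subseteq> B \<and> c * prob B \<le> prob A"
    and cell_prob_pos: "A \<in> P n \<Longrightarrow> 0 < prob A"
    and c_pos: "0 < c"
    and small_cells: "open U \<Longrightarrow> x \<in> U \<Longrightarrow> x \<in> K \<Longrightarrow> \<exists>n. \<exists>A\<in>P n. x \<in> A \<and> A \<subseteq> U"

lemma (in finite_measure) integrable_indicator_event:
  "A \<in> sets M \<Longrightarrow> integrable M (indicator A :: _ \<Rightarrow> real)"
  by (intro integrable_real_indicator) (simp_all add: emeasure_eq_measure)

locale nested_partitions_function = nested_partitions +
  fixes g :: "'a \<Rightarrow> real"
  assumes integrable_g: "integrable M g"
    and g_nonneg: "0 \<le> g x"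
    and g_outside: "x \<notin> K \<Longrightarrow> g x = 0"
begin

definition cell_mean :: "'a set \<Rightarrow> real" where
  "cell_mean A = (\<integral>x. indicator A x * g x \<partial>M) / prob A"

definition mean :: "nat \<Rightarrow> 'a \<Rightarrow> real" where
  "mean n x = (\<Sum>A\<in>P n. indicator A x * cell_mean A)"

text \<open>Level \<open>0\<close>, which consists of \<open>K\<close> alone, is left out of the supremum, as it is in the maximal
  operator on the basic cubes. In exchange \<open>l\<close> below will dominate the mean over \<open>K\<close>.\<close>

definition maximal :: "'a \<Rightarrow> ennreal" where
  "maximal x = (SUP n\<in>{1..}. ennreal (mean n x))"

primrec running_max :: "real \<Rightarrow> nat \<Rightarrow> 'a \<Rightarrow> real" where
  "running_max l 0 x = l"
| "running_max l (Suc n) x = max (running_max l n x) (mean (Suc n) x)"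

definition cellwise_constant :: "nat \<Rightarrow> ('a \<Rightarrow> real) \<Rightarrow> bool" where
  "cellwise_constant n u \<longleftrightarrow> (\<forall>A\<in>P n. \<exists>a. \<forall>x\<in>A. u x = a)"

lemma measurable_g [measurable]: "g \<in> borel_measurable M"
  using integrable_g by auto

lemma sum_cells:
  assumes "A \<in> P n" "x \<in> A"
  shows "(\<Sum>B\<in>P n. indicator B x * u B) = (u A :: real)"
proof -
  have "(\<Sum>B\<in>P n. indicator B x * u B) = (\<Sum>B\<in>P n. if B = A then u B else 0)"
    using assms cells_disjoint by (intro sum.cong) (auto simp: indicator_def)
  then show ?thesis using assms finite_cells by simp
qed

lemma sum_cells_outside:
  assumes "x \<notin> K"
  shows "(\<Sum>B\<in>P n. indicator B x * u B) = (0 :: real)"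
  using assms cells_cover by (intro sum.neutral) (auto simp: indicator_def)

lemma mean_eq: "A \<in> P n \<Longrightarrow> x \<in> A \<Longrightarrow> mean n x = cell_mean A"
  unfolding mean_def by (rule sum_cells)

lemma mean_outside: "x \<notin> K \<Longrightarrow> mean n x = 0"
  unfolding mean_def by (rule sum_cells_outside)

lemma integrable_cell: "A \<in> P n \<Longrightarrow> integrable M (\<lambda>x. indicator A x * g x)"
  using integrable_real_mult_indicator [OF cell_borel integrable_g] by (simp add: mult.commute)

lemma measurable_mean [measurable]: "mean n \<in> borel_measurable M"
  unfolding mean_def [abs_def] using cell_borel by (intro borel_measurable_sum) auto

lemma measurable_maximal [measurable]: "maximal \<in> borel_measurable M"
  unfolding maximal_def [abs_def] by measurable

lemma mean_le_maximal: "1 \<le> n \<Longrightarrow> ennreal (mean n x) \<le> maximal x"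
  unfolding maximal_def by (rule SUP_upper) simp

text \<open>The means form the conditional expectation of \<open>g\<close> with respect to the algebra generated by the
  cells of one level; a cellwise constant factor can be pulled out of it.\<close>

lemma
  assumes "cellwise_constant n u"
  shows integrable_times_cellwise: "integrable M (\<lambda>x. g x * u x)"
    and integrable_mean_times_cellwise: "integrable M (\<lambda>x. mean n x * u x)"
    and integral_times_cellwise: "(\<integral>x. g x * u x \<partial>M) = (\<integral>x. mean n x * u x \<partial>M)"
proof -
  obtain a where a: "\<And>A x. A \<in> P n \<Longrightarrow> x \<in> A \<Longrightarrow> u x = a A"
    using assms(1) unfolding cellwise_constant_def by metis
  have g: "g x * u x = (\<Sum>A\<in>P n. a A * (indicator A x * g x))"
    and m: "mean n x * u x = (\<Sum>A\<in>P n. a A * cell_mean A * indicator A x)" for x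
  proof -
    have "g x * u x = (\<Sum>A\<in>P n. a A * (indicator A x * g x)) \<and>
        mean n x * u x = (\<Sum>A\<in>P n. a A * cell_mean A * indicator A x)"
    proof (cases "x \<in> K")
      case True
      then obtain A where A: "A \<in> P n" "x \<in> A" using cells_cover by blast
      then show ?thesis
        using sum_cells [OF A, of "\<lambda>B. a B * g x"] sum_cells [OF A, of "\<lambda>B. a B * cell_mean B"] a
        by (simp add: mult_ac mean_eq)
    next
      case False
      then show ?thesis
        using sum_cells_outside [OF False, of "\<lambda>B. a B * cell_mean B" n]
        by (simp add: g_outside mean_outside mult_ac)
    qed
    then show "g x * u x = (\<Sum>A\<in>P n. a A * (indicator A x * g x))"
      and "mean n x * u x = (\<Sum>A\<in>P n. a A * cell_mean A * indicator A x)" by auto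
  qed
  have ig: "integrable M (\<lambda>x. a A * (indicator A x * g x))" if "A \<in> P n" for A
    using integrable_cell [OF that] by simp
  have im: "integrable M (\<lambda>x. a A * cell_mean A * indicator A x)" if "A \<in> P n" for A
    using cell_borel [OF that] by (intro integrable_mult_right integrable_indicator_event) simp
  show "integrable M (\<lambda>x. g x * u x)"
    unfolding g by (intro Bochner_Integration.integrable_sum ig)
  show "integrable M (\<lambda>x. mean n x * u x)"
    unfolding m by (intro Bochner_Integration.integrable_sum im)
  have "(\<integral>x. g x * u x \<partial>M) = (\<Sum>A\<in>P n. a A * (\<integral>x. indicator A x * g x \<partial>M))"
    unfolding g by (subst Bochner_Integration.integral_sum) (use ig in auto)
  also have "\<dots> = (\<Sum>A\<in>P n. a A * cell_mean A * prob A)"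
    by (intro sum.cong) (auto simp: cell_mean_def dest: cell_prob_pos)
  also have "\<dots> = (\<integral>x. mean n x * u x \<partial>M)"
    unfolding m by (subst Bochner_Integration.integral_sum)
      (use im in \<open>auto simp: cell_borel intro!: sum.cong\<close>)
  finally show "(\<integral>x. g x * u x \<partial>M) = (\<integral>x. mean n x * u x \<partial>M)" .
qed

lemma cellwise_constantI:
  assumes "\<And>A x y. A \<in> P n \<Longrightarrow> x \<in> A \<Longrightarrow> y \<in> A \<Longrightarrow> u x = u y"
  shows "cellwise_constant n u"
  unfolding cellwise_constant_def
proof (intro ballI exI)
  fix A x assume "A \<in> P n" "x \<in> A"
  then show "u x = u (SOME y. y \<in> A)" using assms someI by metis
qed

lemma cellwise_constant_combine:
  assumes "cellwise_constant n u" "cellwise_constant n v"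
  shows "cellwise_constant n (\<lambda>x. h (u x) (v x))"
  using assms unfolding cellwise_constant_def by metis

lemma cellwise_constant_ln: "cellwise_constant n u \<Longrightarrow> cellwise_constant n (\<lambda>x. ln (u x))"
  unfolding cellwise_constant_def by metis

lemma cellwise_constant_const: "cellwise_constant n (\<lambda>x. a)"
  unfolding cellwise_constant_def by blast

lemma cellwise_constant_Suc:
  assumes "cellwise_constant n u"
  shows "cellwise_constant (Suc n) u"
  using assms parent_cell unfolding cellwise_constant_def by (metis subset_iff)

lemma cellwise_constant_mono:
  assumes "cellwise_constant k u" "k \<le> n"
  shows "cellwise_constant n u"
  using assms(2,1) by (induction n rule: dec_induct) (auto intro: cellwise_constant_Suc)

lemma cellwise_constant_mean: "cellwise_constant n (mean n)"
  unfolding cellwise_constant_def using mean_eq by blast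

lemma cellwise_constant_running_max: "cellwise_constant n (running_max l n)"
proof (induction n)
  case (Suc n)
  show ?case
    using cellwise_constant_combine [OF cellwise_constant_Suc [OF Suc] cellwise_constant_mean, of max]
    by simp
qed (simp add: cellwise_constant_def)

text \<open>The integral of the nonnegative \<open>g\<close> grows when passing from a cell to its parent, whereas the mass
  grows at most by the factor \<open>1 / c\<close>.\<close>

lemma mean_Suc_le: "mean (Suc n) x \<le> mean n x / c"
proof (cases "x \<in> K")
  case True
  then obtain A where A: "A \<in> P (Suc n)" "x \<in> A" using cells_cover by blast
  then obtain B where B: "B \<in> P n" "A \<subseteq> B" "c * prob B \<le> prob A"
    using parent_cell by blast
  have "0 < c * prob B" using B cell_prob_pos c_pos by simp
  have "(\<integral>x. indicator A x * g x \<partial>M) \<le> (\<integral>x. indicator B x * g x \<partial>M)"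
    using A B by (intro integral_mono integrable_cell) (auto simp: indicator_def g_nonneg)
  then have "cell_mean A \<le> (\<integral>x. indicator B x * g x \<partial>M) / (c * prob B)"
    unfolding cell_mean_def using \<open>0 < c * prob B\<close> B
    by (intro frac_le integral_nonneg_AE) (auto simp: g_nonneg)
  then show ?thesis
    using A B by (simp add: mean_eq [of A "Suc n"] mean_eq [of B n] subset_iff cell_mean_def mult_ac)
qed (simp add: mean_outside)

lemma running_max_ge: "l \<le> running_max l n x"
  by (induction n) auto

lemma running_max_mono: "k \<le> n \<Longrightarrow> running_max l k x \<le> running_max l n x"
  by (induction n rule: dec_induct) auto

lemma mean_le_running_max: "1 \<le> n \<Longrightarrow> mean n x \<le> running_max l n x"
  by (cases n) auto

lemma measurable_running_max [measurable]: "running_max l n \<in> borel_measurable M"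
proof (induction n)
  case 0
  then show ?case by (simp cong: measurable_cong)
next
  case (Suc n)
  note [measurable] = this
  show ?case by (simp cong: measurable_cong)
qed

lemma integrable_running_max: "integrable M (running_max l n)"
proof (induction n)
  case (Suc n)
  have "integrable M (mean (Suc n))"
    using integrable_mean_times_cellwise [OF cellwise_constant_const [of _ 1]] by simp
  with Suc show ?case by (simp add: integrable_max cong: integrable_cong)
qed (simp cong: integrable_cong)

lemma running_max_le_maximal:
  assumes "0 \<le> l"
  shows "ennreal (running_max l n x - l) \<le> maximal x"
proof (induction n)
  case (Suc n)
  have "ennreal (mean (Suc n) x - l) \<le> ennreal (mean (Suc n) x)"
    using assms by (intro ennreal_leI) simp
  also have "\<dots> \<le> maximal x" by (rule mean_le_maximal) simp
  finally show ?case using Suc by (simp add: max_def)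
qed simp

lemma mean_0_le: "mean 0 x \<le> (\<integral>x. g x \<partial>M) / prob K"
proof (cases "x \<in> K")
  case True
  have "(\<lambda>x. indicator K x * g x) = g" using g_outside by (auto simp: indicator_def fun_eq_iff)
  then show ?thesis using True mean_eq [of K 0 x] by (simp add: cells_0 cell_mean_def)
next
  case False
  then show ?thesis by (simp add: mean_outside g_nonneg integral_nonneg_AE)
qed

text \<open>Either the running maximum \<open>a\<close> stays the same and both sides vanish, or it jumps to the new mean
  \<open>b\<close>. In the second case \<open>b \<le> a / c\<close> because the previous mean was at most \<open>a\<close>, and
  \<open>ln b - ln a \<le> (b - a) / a\<close>. The bound on \<open>l\<close> makes the argument start at level \<open>0\<close>.\<close>

lemma log_increment:
  assumes "0 < l" "(\<integral>x. g x \<partial>M) / prob K \<le> l"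
  shows "mean (Suc n) x * (ln (running_max l (Suc n) x) - ln (running_max l n x))
    \<le> (running_max l (Suc n) x - running_max l n x) / c"
proof (cases "mean (Suc n) x \<le> running_max l n x")
  case True
  then show ?thesis by (simp add: max_def)
next
  case False
  define a b where "a = running_max l n x" and "b = mean (Suc n) x"
  have "0 < a" unfolding a_def using running_max_ge [of l n x] assms by linarith
  have "a < b" using False by (simp add: a_def b_def)
  have "mean n x \<le> a"
    using mean_0_le [of x] assms mean_le_running_max [of n x l] unfolding a_def by (cases n) auto
  then have "b \<le> a / c"
    using mean_Suc_le [of n x] c_pos unfolding b_def
    by (meson divide_right_mono le_less order_trans)
  have "ln b - ln a \<le> (b - a) / a"
    using \<open>0 < a\<close> \<open>a < b\<close> ln_le_minus_one [of "b / a"] by (simp add: ln_div field_simps)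
  then have "b * (ln b - ln a) \<le> b * ((b - a) / a)"
    using \<open>0 < a\<close> \<open>a < b\<close> by (intro mult_left_mono) auto
  also have "\<dots> \<le> (a / c) * ((b - a) / a)"
    using \<open>b \<le> a / c\<close> \<open>0 < a\<close> \<open>a < b\<close> by (intro mult_right_mono) auto
  also have "\<dots> = (b - a) / c" using \<open>0 < a\<close> by simp
  finally show ?thesis using False by (simp add: a_def b_def max_def)
qed

text \<open>Telescoping sum of the preceding inequality. The increment of the logarithm at step \<open>n\<close> is constant
  on the cells of level \<open>n + 1\<close>, so its integral against \<open>g\<close> and against the mean of that level agree.\<close>

lemma integral_log_running_max:
  assumes "0 < l" "(\<integral>x. g x \<partial>M) / prob K \<le> l"
  shows "(\<integral>x. g x * ln (running_max l n x) \<partial>M)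
    \<le> (\<integral>x. g x \<partial>M) * ln l + (\<integral>x. running_max l n x - l \<partial>M) / c"
proof (induction n)
  case (Suc n)
  let ?N = "running_max l n" and ?N' = "running_max l (Suc n)"
  have N': "cellwise_constant (Suc n) (\<lambda>x. ln (?N' x))"
    by (intro cellwise_constant_ln cellwise_constant_running_max)
  have N: "cellwise_constant (Suc n) (\<lambda>x. ln (?N x))"
    by (intro cellwise_constant_ln cellwise_constant_Suc cellwise_constant_running_max)
  have D: "cellwise_constant (Suc n) (\<lambda>x. ln (?N' x) - ln (?N x))"
    using cellwise_constant_combine [OF N' N, of "(-)"] .
  have "(\<integral>x. g x * ln (?N' x) \<partial>M) - (\<integral>x. g x * ln (?N x) \<partial>M)
      = (\<integral>x. g x * (ln (?N' x) - ln (?N x)) \<partial>M)"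
    using integrable_times_cellwise [OF N] integrable_times_cellwise [OF N']
    by (simp only: right_diff_distrib Bochner_Integration.integral_diff)
  also have "\<dots> = (\<integral>x. mean (Suc n) x * (ln (?N' x) - ln (?N x)) \<partial>M)"
    by (rule integral_times_cellwise [OF D])
  also have "\<dots> \<le> (\<integral>x. (?N' x - ?N x) / c \<partial>M)"
    by (intro integral_mono integrable_mean_times_cellwise [OF D] log_increment assms
        integrable_divide Bochner_Integration.integrable_diff integrable_running_max)
  also have "\<dots> = (\<integral>x. ?N' x - l \<partial>M) / c - (\<integral>x. ?N x - l \<partial>M) / c"
    using integrable_running_max [of l n] integrable_running_max [of l "Suc n"]
    by (simp add: prob_space diff_divide_distrib del: running_max.simps)
  finally show ?case using Suc by linarith
qed simp

text \<open>A substitute for Lebesgue's differentiation theorem that needs no covering argument. Let \<open>F\<close> be the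
  set where all means are at most \<open>q\<close>. For open \<open>U\<close>, the set \<open>F \<inter> U\<close> is the limit of the sets
  \<open>E n \<inter> V n\<close>, where \<open>E n\<close> only involves the levels up to \<open>n\<close> and \<open>V n\<close> is the union of the cells of level
  \<open>n\<close> inside \<open>U\<close>. These are unions of cells of level \<open>n\<close> on which the mean of \<open>g\<close> is at most \<open>q\<close>.
  In the limit the integral of \<open>g\<close> over \<open>F \<inter> U\<close> is at most \<open>q\<close> times the mass of \<open>U\<close>. By outer
  regularity the integral of \<open>g\<close> over a measurable \<open>A \<subseteq> F\<close> is at most \<open>q\<close> times the mass of \<open>A\<close>;
  if also \<open>g > q\<close> on \<open>A\<close>, then \<open>A\<close> is a null set.\<close>

lemma AE_maximal_le_imp_le:
  assumes "0 \<le> q"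
  shows "AE x in M. \<not> (maximal x \<le> ennreal q \<and> q < g x)"
proof -
  define E where "E n = {x \<in> K. \<forall>k\<in>{1..n}. mean k x \<le> q}" for n
  define F where "F = {x \<in> K. \<forall>k\<ge>1. mean k x \<le> q}"
  have K_borel [measurable]: "K \<in> sets M" using cell_borel [of K 0] by (simp add: cells_0)
  have E_borel [measurable]: "E n \<in> sets M" for n
  proof -
    have "E n = {x \<in> space M. x \<in> K \<and> (\<forall>k\<in>{1..n}. mean k x \<le> q)}"
      using sets.sets_into_space [OF K_borel] by (auto simp: E_def)
    then show ?thesis by simp
  qed
  have F_borel [measurable]: "F \<in> sets M"
  proof -
    have "F = {x \<in> space M. x \<in> K \<and> (\<forall>k\<in>{1..}. mean k x \<le> q)}"
      using sets.sets_into_space [OF K_borel] by (auto simp: F_def)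
    then show ?thesis by simp
  qed
  have open_bound: "(\<integral>x. g x * indicator (F \<inter> U) x \<partial>M) \<le> q * prob U" if "open U" for U
  proof -
    define V where "V n = \<Union>{A \<in> P n. A \<subseteq> U}" for n
    have U_borel [measurable]: "U \<in> sets M" using that by (simp add: sets_eq_borel)
    have V_borel [measurable]: "V n \<in> sets M" for n
      unfolding V_def using finite_cells cell_borel by (intro sets.finite_Union) auto
    have V_subset: "V n \<subseteq> U" for n by (auto simp: V_def)
    have V_Suc: "V n \<subseteq> V (Suc n)" for n
    proof
      fix x assume "x \<in> V n"
      then obtain A where A: "A \<in> P n" "A \<subseteq> U" "x \<in> A" by (auto simp: V_def)
      then have "x \<in> K" using cells_cover by blast
      then obtain A' where A': "A' \<in> P (Suc n)" "x \<in> A'" using cells_cover by blast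
      then obtain B where B: "B \<in> P n" "A' \<subseteq> B" using parent_cell by blast
      then have "B = A" using A A' cells_disjoint by blast
      then show "x \<in> V (Suc n)" using A A' B by (auto simp: V_def)
    qed
    have cw: "cellwise_constant n (\<lambda>x. indicator (E n \<inter> V n) x)" for n
    proof -
      have "x \<in> E n \<inter> V n" if "A \<in> P n" "x \<in> A" "y \<in> A" "y \<in> E n \<inter> V n" for A x y
      proof -
        have "mean k x = mean k y" if "k \<le> n" for k
          using cellwise_constant_mono [OF cellwise_constant_mean that] \<open>A \<in> P n\<close> \<open>x \<in> A\<close> \<open>y \<in> A\<close>
          unfolding cellwise_constant_def by metis
        moreover have "A \<subseteq> U" using that cells_disjoint unfolding V_def by blast
        moreover have "x \<in> K" using that cells_cover by blast
        ultimately show ?thesis using that by (auto simp: E_def V_def)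
      qed
      then have iff: "x \<in> E n \<inter> V n \<longleftrightarrow> y \<in> E n \<inter> V n"
        if "A \<in> P n" "x \<in> A" "y \<in> A" for A x y
        using that by blast
      show ?thesis
        unfolding indicator_def
        by (rule cellwise_constantI, rule arg_cong [where f = of_bool], rule iff)
    qed
    have le: "(\<integral>x. g x * indicator (E n \<inter> V n) x \<partial>M) \<le> q * prob U" if "1 \<le> n" for n
    proof -
      have "(\<integral>x. g x * indicator (E n \<inter> V n) x \<partial>M)
          = (\<integral>x. mean n x * indicator (E n \<inter> V n) x \<partial>M)"
        by (rule integral_times_cellwise [OF cw])
      also have "\<dots> \<le> (\<integral>x. q * indicator U x \<partial>M)"
      proof (intro integral_mono integrable_mean_times_cellwise [OF cw])
        show "integrable M (\<lambda>x. q * indicator U x)" by (intro integrable_mult_right integrable_indicator_event) simp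
        show "mean n x * indicator (E n \<inter> V n) x \<le> q * indicator U x" for x
          using that V_subset [of n] \<open>0 \<le> q\<close> by (auto simp: indicator_def E_def)
      qed
      also have "\<dots> = q * prob U" by simp
      finally show ?thesis .
    qed
    have "(\<lambda>n. \<integral>x. g x * indicator (E n \<inter> V n) x \<partial>M)
        \<longlonglongrightarrow> (\<integral>x. g x * indicator (F \<inter> U) x \<partial>M)"
    proof (rule integral_dominated_convergence [where w = g])
      show "AE x in M. (\<lambda>n. g x * indicator (E n \<inter> V n) x) \<longlonglongrightarrow> g x * indicator (F \<inter> U) x"
      proof (intro AE_I2 tendsto_mult tendsto_const tendsto_eventually)
        fix x
        consider "x \<in> F \<inter> U" | "x \<notin> F" | "x \<notin> U" by blast
        then show "\<forall>\<^sub>F n in sequentially.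
            indicator (E n \<inter> V n) x = (indicator (F \<inter> U) x :: real)"
        proof cases
          case 1
          then obtain N A where "A \<in> P N" "x \<in> A" "A \<subseteq> U"
            using small_cells [OF \<open>open U\<close>, of x] by (auto simp: F_def)
          then have "x \<in> V N" by (auto simp: V_def)
          then have "x \<in> V n" if "N \<le> n" for n
            using lift_Suc_mono_le [of V, OF V_Suc that] by blast
          moreover have "x \<in> E n" for n using 1 by (auto simp: E_def F_def)
          ultimately show ?thesis
            using 1 by (auto simp: eventually_sequentially intro!: exI [of _ N])
        next
          case 2
          show ?thesis
          proof (cases "x \<in> K")
            case True
            with 2 obtain k where "1 \<le> k" "\<not> mean k x \<le> q" by (auto simp: F_def)
            then have "x \<notin> E n" if "k \<le> n" for n using that by (auto simp: E_def)
            with 2 show ?thesis by (auto simp: eventually_sequentially intro!: exI [of _ k])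
          qed (use 2 in \<open>auto simp: E_def\<close>)
        next
          case 3
          then have "x \<notin> V n" for n using V_subset by blast
          then show ?thesis using 3 by simp
        qed
      qed
      show "integrable M g" by (rule integrable_g)
      show "AE x in M. norm (g x * indicator (E n \<inter> V n) x) \<le> g x" for n
        by (intro AE_I2) (auto simp: indicator_def g_nonneg)
    qed measurable
    then show ?thesis
      by (rule LIMSEQ_le_const2) (use le in auto)
  qed
  define A where "A = {x \<in> F. q < g x}"
  have A_borel [measurable]: "A \<in> sets M"
  proof -
    have "A = {x \<in> space M. x \<in> F \<and> q < g x}"
      using sets.sets_into_space [OF F_borel] by (auto simp: A_def)
    then show ?thesis by simp
  qed
  have iA: "integrable M (\<lambda>x. g x * indicator A x)"
    using integrable_g by (rule integrable_real_mult_indicator [OF A_borel])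
  have "(\<integral>x. g x * indicator A x \<partial>M) \<le> q * prob A"
  proof (rule field_le_epsilon)
    fix e :: real assume "0 < e"
    \<comment> \<open>The tolerance has denominator \<open>q + 1\<close> rather than \<open>q\<close> because \<open>q\<close> may be zero.\<close>
    have "emeasure M A = (INF U\<in>{U. A \<subseteq> U \<and> open U}. emeasure M U)"
      by (rule outer_regular) (use sets_eq_borel A_borel in auto)
    moreover have "emeasure M A < emeasure M A + ennreal (e / (q + 1))"
      using \<open>0 < e\<close> \<open>0 \<le> q\<close> by (simp add: emeasure_eq_measure)
    ultimately obtain U where U: "A \<subseteq> U" "open U"
      "emeasure M U < emeasure M A + ennreal (e / (q + 1))"
      by (metis (no_types, lifting) INF_less_iff mem_Collect_eq)
    have U_borel [measurable]: "U \<in> sets M" using U by (simp add: sets_eq_borel)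
    have "prob U \<le> prob A + e / (q + 1)"
      using U(3) \<open>0 < e\<close> \<open>0 \<le> q\<close>
      by (simp add: emeasure_eq_measure ennreal_plus [symmetric] ennreal_less_iff
          del: ennreal_plus)
    then have "q * prob U \<le> q * prob A + q * (e / (q + 1))"
      using \<open>0 \<le> q\<close> mult_left_mono by (fastforce simp: distrib_left)
    also have "q * (e / (q + 1)) \<le> e" using \<open>0 < e\<close> \<open>0 \<le> q\<close> by (simp add: field_simps)
    finally have "q * prob U \<le> q * prob A + e" by simp
    moreover have "(\<integral>x. g x * indicator A x \<partial>M) \<le> (\<integral>x. g x * indicator (F \<inter> U) x \<partial>M)"
      using U(1) by (intro integral_mono iA integrable_real_mult_indicator integrable_g)
        (auto simp: indicator_def A_def g_nonneg)
    ultimately show "(\<integral>x. g x * indicator A x \<partial>M) \<le> q * prob A + e"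
      using open_bound [OF U(2)] by linarith
  qed
  moreover have iq: "integrable M (\<lambda>x. q * indicator A x)"
    by (intro integrable_mult_right integrable_indicator_event) simp
  ultimately have "(\<integral>x. g x * indicator A x - q * indicator A x \<partial>M) \<le> 0"
    using iA by simp
  moreover have nn: "AE x in M. 0 \<le> g x * indicator A x - q * indicator A x"
    by (intro AE_I2) (auto simp: indicator_def A_def)
  ultimately have "(\<integral>x. g x * indicator A x - q * indicator A x \<partial>M) = 0"
    using integral_nonneg_AE [OF nn] by linarith
  then have "AE x in M. g x * indicator A x - q * indicator A x = 0"
    using integral_nonneg_eq_0_iff_AE [OF Bochner_Integration.integrable_diff [OF iA iq] nn] by simp
  then show ?thesis
  proof (rule AE_mp, intro AE_I2 impI notI)
    fix x
    assume 0: "g x * indicator A x - q * indicator A x = 0"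
      and x: "maximal x \<le> ennreal q \<and> q < g x"
    have "mean k x \<le> q" if "1 \<le> k" for k
      using mean_le_maximal [OF that, of x] x \<open>0 \<le> q\<close> by (meson ennreal_le_iff order_trans)
    moreover have "x \<in> K" using x \<open>0 \<le> q\<close> g_outside by force
    ultimately have "x \<in> A" using x by (auto simp: A_def F_def)
    then show False using 0 x by simp
  qed
qed

lemma AE_le_maximal: "AE x in M. ennreal (g x) \<le> maximal x"
proof -
  have "AE x in M. \<forall>q\<in>{q\<in>\<rat>. 0 \<le> q}. \<not> (maximal x \<le> ennreal q \<and> q < g x)"
    using AE_maximal_le_imp_le by (intro AE_ball_countable [THEN iffD2])
      (auto simp: countable_rat intro: countable_subset [OF _ countable_rat])
  then show ?thesis
  proof (rule AE_mp, intro AE_I2 impI)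
    fix x assume *: "\<forall>q\<in>{q\<in>\<rat>. 0 \<le> q}. \<not> (maximal x \<le> ennreal q \<and> q < g x)"
    show "ennreal (g x) \<le> maximal x"
    proof (rule ccontr)
      assume less: "\<not> ennreal (g x) \<le> maximal x"
      then obtain y where y: "0 \<le> y" "maximal x = ennreal y"
        by (cases "maximal x") auto
      with less have "y < g x" by (simp add: ennreal_less_iff not_le)
      then obtain q where "q \<in> \<rat>" "y < q" "q < g x" using Rats_dense_in_real by blast
      then show False using * y by (auto simp: ennreal_leI)
    qed
  qed
qed

text \<open>Passing to the limit in the telescoped inequality. Monotone convergence applies since \<open>l \<ge> 1\<close> makes
  all logarithms nonnegative, and almost everywhere the limit of \<open>g ln N\<^sub>n\<close> is at least \<open>g log\<^sup>+ g\<close>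
  because some mean comes as close to \<open>g\<close> from below as one likes. On the right, both \<open>\<integral> g\<close> and
  \<open>\<integral> (N\<^sub>n - l)\<close> are at most the integral of the maximal function.\<close>

theorem log_integral_le:
  assumes "1 \<le> l" "(\<integral>x. g x \<partial>M) / prob K \<le> l"
  shows "(\<integral>\<^sup>+x. ennreal (g x * log_plus (g x)) \<partial>M)
    \<le> ennreal (ln l + 1 / c) * (\<integral>\<^sup>+x. maximal x \<partial>M)"
proof -
  let ?I = "\<integral>\<^sup>+x. maximal x \<partial>M"
  have N_ge: "1 \<le> running_max l n x" for n x using running_max_ge assms(1) order_trans by blast
  have log_le: "ennreal (g x * log_plus (g x)) \<le> (SUP n. ennreal (g x * ln (running_max l n x)))"
    if "ennreal (g x) \<le> maximal x" for x
    unfolding le_SUP_iff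
  proof (intro allI impI)
    fix y assume y: "y < ennreal (g x * log_plus (g x))"
    then have "g x * log_plus (g x) > 0" by (metis ennreal_eq_0_iff not_le not_less_zero)
    then have "0 < g x" "0 < ln (g x)"
      using g_nonneg [of x] by (auto simp: log_plus_def zero_less_mult_iff max_def split: if_splits)
    then have lp: "log_plus (g x) = ln (g x)" by (simp add: log_plus_def)
    obtain z where z: "0 \<le> z" "y = ennreal z" using y by (cases y) auto
    \<comment> \<open>Solve \<open>g x * ln t > z\<close> for \<open>t\<close>: it suffices that some mean exceeds \<open>exp (z / g x)\<close>.\<close>
    then have "z / g x < ln (g x)"
      using y lp \<open>0 < g x\<close> by (simp add: ennreal_less_iff field_simps)
    then have "exp (z / g x) < g x" using \<open>0 < g x\<close> by (metis exp_less_mono exp_ln)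
    then have "ennreal (exp (z / g x)) < maximal x"
      using that by (meson ennreal_lessI \<open>0 < g x\<close> less_le_trans)
    then obtain n where n: "1 \<le> n" "exp (z / g x) < mean n x"
      unfolding maximal_def less_SUP_iff by (auto simp: ennreal_less_iff)
    then have "exp (z / g x) < running_max l n x"
      using mean_le_running_max [of n x l] by linarith
    then have "z / g x < ln (running_max l n x)"
      using N_ge [of n x] by (metis exp_gt_zero ln_exp ln_less_cancel_iff order_less_trans)
    then have "z < g x * ln (running_max l n x)" using \<open>0 < g x\<close> by (simp add: field_simps)
    then show "\<exists>n\<in>UNIV. y < ennreal (g x * ln (running_max l n x))"
      using z by (auto simp: ennreal_less_iff)
  qed
  have "(\<integral>\<^sup>+x. ennreal (g x * log_plus (g x)) \<partial>M)
      \<le> (\<integral>\<^sup>+x. (SUP n. ennreal (g x * ln (running_max l n x))) \<partial>M)"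
    using AE_le_maximal by (intro nn_integral_mono_AE) (auto elim!: AE_mp simp: log_le)
  also have "\<dots> = (SUP n. \<integral>\<^sup>+x. ennreal (g x * ln (running_max l n x)) \<partial>M)"
  proof (intro nn_integral_monotone_convergence_SUP incseq_SucI le_funI)
    fix n x
    show "ennreal (g x * ln (running_max l n x)) \<le> ennreal (g x * ln (running_max l (Suc n) x))"
      using N_ge [of n x] N_ge [of "Suc n" x] running_max_mono [of n "Suc n" l x] g_nonneg [of x]
      by (intro ennreal_leI mult_left_mono) auto
  qed measurable
  also have "\<dots> \<le> ennreal (ln l + 1 / c) * ?I"
  proof (rule SUP_least)
    fix n
    have c: "cellwise_constant n (\<lambda>x. ln (running_max l n x))"
      by (intro cellwise_constant_ln cellwise_constant_running_max)
    have "(\<integral>\<^sup>+x. ennreal (g x * ln (running_max l n x)) \<partial>M)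
        = ennreal (\<integral>x. g x * ln (running_max l n x) \<partial>M)"
      using N_ge g_nonneg by (intro nn_integral_eq_integral integrable_times_cellwise [OF c]) auto
    also have "\<dots> \<le> ennreal ((\<integral>x. g x \<partial>M) * ln l + (\<integral>x. running_max l n x - l \<partial>M) / c)"
      using integral_log_running_max assms by (intro ennreal_leI) simp
    also have "\<dots> = ennreal (ln l) * ennreal (\<integral>x. g x \<partial>M)
        + ennreal (1 / c) * ennreal (\<integral>x. running_max l n x - l \<partial>M)"
    proof -
      have "0 \<le> (\<integral>x. g x \<partial>M)" "0 \<le> (\<integral>x. running_max l n x - l \<partial>M)"
        by (auto intro!: integral_nonneg_AE simp: g_nonneg running_max_ge)
      then show ?thesis
        using assms(1) c_pos by (simp add: ennreal_plus ennreal_mult [symmetric] mult.commute)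
    qed
    also have "\<dots> \<le> ennreal (ln l) * ?I + ennreal (1 / c) * ?I"
    proof (intro add_mono mult_left_mono)
      have "ennreal (\<integral>x. g x \<partial>M) = (\<integral>\<^sup>+x. ennreal (g x) \<partial>M)"
        using integrable_g g_nonneg by (intro nn_integral_eq_integral [symmetric]) auto
      also have "\<dots> \<le> ?I" by (intro nn_integral_mono_AE AE_le_maximal)
      finally show "ennreal (\<integral>x. g x \<partial>M) \<le> ?I" .
      have "ennreal (\<integral>x. running_max l n x - l \<partial>M)
          = (\<integral>\<^sup>+x. ennreal (running_max l n x - l) \<partial>M)"
        using running_max_ge
        by (intro nn_integral_eq_integral [symmetric] Bochner_Integration.integrable_diff
            integrable_running_max) auto
      also have "\<dots> \<le> ?I"
        using assms(1) by (intro nn_integral_mono running_max_le_maximal) auto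
      finally show "ennreal (\<integral>x. running_max l n x - l \<partial>M) \<le> ?I" .
    qed auto
    also have "\<dots> = ennreal (ln l + 1 / c) * ?I"
      using assms(1) c_pos by (simp add: ennreal_plus distrib_right)
    finally show "(\<integral>\<^sup>+x. ennreal (g x * ln (running_max l n x)) \<partial>M) \<le> ennreal (ln l + 1 / c) * ?I" .
  qed
  finally show ?thesis .
qed

end

section \<open>Cubes of a separated self-similar set\<close>

lemma words_0: "words m 0 = {[]}"
  by (auto simp: words_def)

lemma words_Suc: "words m (Suc n) = (\<Union>i\<in>{1..m}. (#) i ` words m n)"
  by (auto simp: words_def length_Suc_conv image_iff)

lemma words_Suc_snoc:
  assumes "w \<in> words m (Suc n)"
  obtains u i where "w = u @ [i]" "u \<in> words m n" "i \<in> {1..m}"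
proof -
  from assms have "w \<noteq> []" by (auto simp: words_def)
  then obtain u i where "w = u @ [i]" by (meson rev_exhaust)
  with assms show thesis by (intro that [of u i]) (auto simp: words_def)
qed

lemma finite_words: "finite (words m n)"
  using finite_lists_length_eq [of "{1..m}" n] by (simp add: words_def conj_commute)

lemma basic_cube_Nil [simp]: "basic_cube S K [] = K"
  by (simp add: basic_cube_def)

lemma basic_cube_Cons [simp]: "basic_cube S K (i # w) = S i ` basic_cube S K w"
  by (simp add: basic_cube_def image_comp)

text \<open>The maps \<open>S i\<close> enter through their scaling of distances, which already makes them injective and
  continuous.\<close>

locale separated_self_similar =
  fixes m :: nat and S :: "nat \<Rightarrow> 'a::euclidean_space \<Rightarrow> 'a" and K :: "'a set"
    and r p :: "nat \<Rightarrow> real" and \<mu> :: "'a measure"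
  assumes ratio: "i \<in> {1..m} \<Longrightarrow> 0 < r i \<and> r i < 1"
    and dist_S: "i \<in> {1..m} \<Longrightarrow> dist (S i x) (S i y) = r i * dist x y"
    and self_similar: "self_similar_set m S K"
    and weight_pos: "i \<in> {1..m} \<Longrightarrow> 0 < p i"
    and weight_sum: "(\<Sum>i\<in>{1..m}. p i) = 1"
    and self_similar_\<mu>: "self_similar_measure m S p \<mu>"
    and separated: "strong_separation m S K"
begin

abbreviation cube :: "nat list \<Rightarrow> 'a set" where
  "cube \<equiv> basic_cube S K"

lemma compact_K: "compact K" and K_nonempty: "K \<noteq> {}" and K_eq: "K = (\<Union>i\<in>{1..m}. S i ` K)"
  using self_similar by (auto simp: self_similar_set_def)

lemma image_K_subset: "i \<in> {1..m} \<Longrightarrow> S i ` K \<subseteq> K"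
  by (subst (2) K_eq) blast

lemma m_pos: "0 < m"
  using K_eq K_nonempty by (cases m) auto

sublocale prob_space \<mu>
  using self_similar_\<mu> by (simp add: self_similar_measure_def)

lemma sets_\<mu> [simp, measurable_cong]: "sets \<mu> = sets borel"
  using self_similar_\<mu> by (simp add: self_similar_measure_def)

lemma space_\<mu> [simp]: "space \<mu> = UNIV"
  using sets_eq_imp_space_eq [OF sets_\<mu>] by simp

lemma emeasure_self_similar:
  "A \<in> sets borel \<Longrightarrow> emeasure \<mu> A = (\<Sum>i\<in>{1..m}. ennreal (p i) * emeasure \<mu> (S i -` A))"
  using self_similar_\<mu> by (simp add: self_similar_measure_def)

lemma inj_S: "i \<in> {1..m} \<Longrightarrow> inj (S i)"
  using dist_S ratio by (intro injI) (metis dist_eq_0_iff less_irrefl mult_eq_0_iff)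

lemma continuous_S: "i \<in> {1..m} \<Longrightarrow> continuous_on A (S i)"
  using dist_S ratio
  by (intro lipschitz_on_continuous_on [of "r i"] lipschitz_onI) (auto simp: less_imp_le)

lemma closed_vimage_S: "i \<in> {1..m} \<Longrightarrow> closed A \<Longrightarrow> closed (S i -` A)"
  using continuous_S by (simp add: closed_vimage)

lemma cube_compact: "w \<in> words m n \<Longrightarrow> compact (cube w)"
  by (induction n arbitrary: w)
    (auto simp: words_0 words_Suc compact_K intro!: compact_continuous_image continuous_S)

lemma cube_subset: "w \<in> words m n \<Longrightarrow> cube w \<subseteq> K"
proof (induction n arbitrary: w)
  case (Suc n)
  then obtain i u where "i \<in> {1..m}" "u \<in> words m n" "w = i # u" by (auto simp: words_Suc)
  with Suc.IH [of u] image_K_subset [of i] show ?case by auto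
qed (simp add: words_0)

lemma cube_snoc_subset: "i \<in> {1..m} \<Longrightarrow> cube (w @ [i]) \<subseteq> cube w"
  using image_K_subset by (induction w) (auto intro: image_mono)

lemma cubes_cover: "(\<Union>w\<in>words m n. cube w) = K"
proof (induction n)
  case (Suc n)
  have "(\<Union>w\<in>words m (Suc n). cube w) = (\<Union>i\<in>{1..m}. S i ` (\<Union>u\<in>words m n. cube u))"
    by (auto simp: words_Suc)
  then show ?case using Suc K_eq by simp
qed (simp add: words_0)

lemma cubes_disjoint:
  "v \<in> words m n \<Longrightarrow> w \<in> words m n \<Longrightarrow> x \<in> cube v \<Longrightarrow> x \<in> cube w \<Longrightarrow> v = w"
proof (induction n arbitrary: v w x)
  case (Suc n)
  obtain i u where v: "v = i # u" "i \<in> {1..m}" "u \<in> words m n"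
    using Suc.prems(1) by (auto simp: words_Suc)
  obtain j t where w: "w = j # t" "j \<in> {1..m}" "t \<in> words m n"
    using Suc.prems(2) by (auto simp: words_Suc)
  obtain y where y: "y \<in> cube u" "x = S i y" using Suc.prems(3) v by auto
  obtain z where z: "z \<in> cube t" "x = S j z" using Suc.prems(4) w by auto
  have "x \<in> S i ` K \<inter> S j ` K" using y z cube_subset v w by blast
  then have "i = j" using separated v w unfolding strong_separation_def by blast
  then have "y = z" using y z inj_S [OF v(2)] by (auto dest: injD)
  then show ?case using Suc.IH [of u t y] \<open>i = j\<close> v w y z by simp
qed (simp add: words_0)

definition max_ratio :: real where
  "max_ratio = Max (r ` {1..m})"

lemma ratio_le_max_ratio: "i \<in> {1..m} \<Longrightarrow> r i \<le> max_ratio"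
  unfolding max_ratio_def by (intro Max_ge) auto

lemma max_ratio: "0 < max_ratio" "max_ratio < 1"
proof -
  have "max_ratio \<in> r ` {1..m}"
    unfolding max_ratio_def using m_pos by (intro Max_in) auto
  then show "0 < max_ratio" "max_ratio < 1" using ratio by auto
qed

lemma cube_dist_le:
  "w \<in> words m n \<Longrightarrow> x \<in> cube w \<Longrightarrow> y \<in> cube w \<Longrightarrow> dist x y \<le> max_ratio ^ n * diameter K"
proof (induction n arbitrary: w x y)
  case 0
  then show ?case using diameter_bounded_bound [OF compact_imp_bounded [OF compact_K]]
    by (simp add: words_0)
next
  case (Suc n)
  then obtain i u x' y' where *: "i \<in> {1..m}" "u \<in> words m n"
    "x' \<in> cube u" "y' \<in> cube u" "x = S i x'" "y = S i y'" by (auto simp: words_Suc)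
  then have "dist x y \<le> max_ratio * dist x' y'"
    using dist_S ratio_le_max_ratio by (simp add: mult_right_mono)
  also have "\<dots> \<le> max_ratio * (max_ratio ^ n * diameter K)"
    using Suc.IH * max_ratio by (intro mult_left_mono) auto
  finally show ?case by (simp add: mult_ac)
qed

lemma infdist_S_le:
  assumes "i \<in> {1..m}"
  shows "infdist (S i x) K \<le> max_ratio * infdist x K"
proof -
  obtain y where y: "y \<in> K" "infdist x K = dist x y"
    using infdist_attains_inf [OF compact_imp_closed [OF compact_K] K_nonempty] by metis
  have "infdist (S i x) K \<le> dist (S i x) (S i y)"
    using image_K_subset [OF assms] y by (intro infdist_le) auto
  also have "\<dots> \<le> max_ratio * dist x y"
    using dist_S ratio_le_max_ratio assms by (simp add: mult_right_mono)
  finally show ?thesis using y by simp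
qed

definition thickening :: "real \<Rightarrow> 'a set" where
  "thickening e = {x. infdist x K \<le> e}"

lemma closed_thickening: "closed (thickening e)"
  unfolding thickening_def by (intro closed_Collect_le continuous_intros)

text \<open>Each \<open>S i\<close> contracts the distance to \<open>K\<close> at least by the factor \<open>max_ratio\<close>. Hence it maps the larger
  thickening into the smaller one, and self-similarity of \<open>\<mu>\<close> compares their masses.\<close>

lemma prob_thickening_le: "prob (thickening (e / max_ratio)) \<le> prob (thickening e)"
proof -
  have "(\<Sum>i\<in>{1..m}. ennreal (p i)) = 1"
    using weight_pos weight_sum by (subst sum_ennreal) (auto simp: less_imp_le)
  then have "emeasure \<mu> (thickening (e / max_ratio))
      = (\<Sum>i\<in>{1..m}. ennreal (p i) * emeasure \<mu> (thickening (e / max_ratio)))"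
    by (simp only: sum_distrib_right [symmetric] mult_1)
  also have "\<dots> \<le> (\<Sum>i\<in>{1..m}. ennreal (p i) * emeasure \<mu> (S i -` thickening e))"
  proof (intro sum_mono mult_left_mono emeasure_mono subsetI)
    fix i x assume i: "i \<in> {1..m}" and "x \<in> thickening (e / max_ratio)"
    then have "max_ratio * infdist x K \<le> e"
      using max_ratio by (simp add: thickening_def field_simps)
    then show "x \<in> S i -` thickening e"
      using infdist_S_le [OF i, of x] by (simp add: thickening_def)
  qed (auto simp: closed_vimage_S closed_thickening)
  also have "\<dots> = emeasure \<mu> (thickening e)"
    by (rule emeasure_self_similar [symmetric]) (simp add: closed_thickening)
  finally show ?thesis by (simp add: emeasure_eq_measure)
qed

text \<open>Iterating the preceding lemma, a thickening has at least the mass of thickenings that exhaust the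
  whole space.\<close>

lemma prob_thickening:
  assumes "0 < e"
  shows "prob (thickening e) = 1"
proof -
  define T where "T n = thickening (e / max_ratio ^ n)" for n
  have le: "prob (T n) \<le> prob (thickening e)" for n
  proof (induction n)
    case (Suc n)
    then show ?case
      using prob_thickening_le [of "e / max_ratio ^ n"] by (simp add: T_def mult_ac)
  qed (simp add: T_def)
  have "incseq T"
  proof (rule incseq_SucI)
    show "T n \<le> T (Suc n)" for n
    proof -
      have "max_ratio ^ Suc n \<le> max_ratio ^ n"
        using max_ratio by (intro power_decreasing) auto
      then have "e / max_ratio ^ n \<le> e / max_ratio ^ Suc n"
        using max_ratio assms by (intro divide_left_mono) auto
      then show ?thesis by (auto simp: T_def thickening_def)
    qed
  qed
  have "x \<in> (\<Union>n. T n)" for x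
  proof -
    obtain n where "max_ratio ^ n < e / (infdist x K + 1)"
      using real_arch_pow_inv [of "e / (infdist x K + 1)" max_ratio] max_ratio assms
        infdist_nonneg [of x K] by auto
    then have "max_ratio ^ n * (infdist x K + 1) < e"
      using infdist_nonneg [of x K] by (simp add: field_simps)
    then have "infdist x K * max_ratio ^ n + max_ratio ^ n < e" by (simp add: algebra_simps)
    moreover have "0 < max_ratio ^ n" using max_ratio by simp
    ultimately have "infdist x K * max_ratio ^ n \<le> e" by linarith
    then have "x \<in> T n" using max_ratio by (simp add: T_def thickening_def field_simps)
    then show ?thesis by blast
  qed
  then have "(\<Union>n. T n) = space \<mu>" by auto
  moreover have "(\<lambda>n. prob (T n)) \<longlonglongrightarrow> prob (\<Union>n. T n)"
  proof (rule finite_Lim_measure_incseq)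
    show "range T \<subseteq> sets \<mu>" using closed_thickening by (auto simp: T_def)
  qed (rule \<open>incseq T\<close>)
  ultimately have "(\<lambda>n. prob (T n)) \<longlonglongrightarrow> 1" by (simp only: prob_space)
  then have "1 \<le> prob (thickening e)" by (rule LIMSEQ_le_const2) (use le in auto)
  then show ?thesis using prob_le_1 [of "thickening e"] by simp
qed

lemma AE_in_K: "AE x in \<mu>. x \<in> K"
proof -
  have "AE x in \<mu>. \<forall>n. x \<in> thickening (1 / real (Suc n))"
    unfolding AE_all_countable using prob_thickening by (intro allI AE_prob_1) simp
  then show ?thesis
  proof (rule AE_mp, intro AE_I2 impI)
    fix x assume *: "\<forall>n. x \<in> thickening (1 / real (Suc n))"
    have "infdist x K \<le> 0"
    proof (rule field_le_epsilon)
      fix e :: real assume "0 < e"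
      then obtain n where "1 / real (Suc n) < e" using nat_approx_posE by metis
      then show "infdist x K \<le> 0 + e"
        using * [rule_format, of n] by (simp add: thickening_def)
    qed
    then show "x \<in> K"
      using in_closed_iff_infdist_zero [OF compact_imp_closed [OF compact_K] K_nonempty]
        infdist_nonneg [of x K] by auto
  qed
qed

text \<open>In the self-similarity relation for \<open>S i ` B\<close> only the term \<open>i\<close> survives: for \<open>j \<noteq> i\<close> the preimage
  under \<open>S j\<close> avoids \<open>K\<close> by strong separation, and \<open>\<mu>\<close> is carried by \<open>K\<close>.\<close>

lemma emeasure_image_S:
  assumes i: "i \<in> {1..m}" and B: "compact B" "B \<subseteq> K"
  shows "emeasure \<mu> (S i ` B) = ennreal (p i) * emeasure \<mu> B"
proof -
  have closed: "closed (S i ` B)"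
    using B i by (intro compact_imp_closed compact_continuous_image continuous_S)
  have other: "emeasure \<mu> (S j -` S i ` B) = 0" if j: "j \<in> {1..m}" "j \<noteq> i" for j
  proof -
    have "AE x in \<mu>. x \<notin> S j -` S i ` B"
    proof (use AE_in_K in \<open>rule AE_mp\<close>, intro AE_I2 impI notI)
      fix x assume "x \<in> K" "x \<in> S j -` S i ` B"
      then have "S j x \<in> S j ` K \<inter> S i ` K" using B by auto
      then show False using separated i j unfolding strong_separation_def by blast
    qed
    then show ?thesis
      using closed_vimage_S [OF j(1) closed] by (subst (asm) AE_iff_measurable) auto
  qed
  have "emeasure \<mu> (S i ` B) = (\<Sum>j\<in>{1..m}. ennreal (p j) * emeasure \<mu> (S j -` S i ` B))"
    using closed by (intro emeasure_self_similar) simp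
  also have "\<dots> = (\<Sum>j\<in>{1..m}. if j = i then ennreal (p i) * emeasure \<mu> B else 0)"
    using other inj_S [OF i] by (intro sum.cong) (auto simp: inj_vimage_image_eq)
  finally show ?thesis using i by simp
qed

lemma prob_cube: "w \<in> words m n \<Longrightarrow> prob (cube w) = prod_list (map p w)"
proof (induction n arbitrary: w)
  case 0
  then show ?case
    using AE_in_K compact_imp_closed [OF compact_K] by (simp add: words_0 prob_eq_1)
next
  case (Suc n)
  then obtain i u where w: "i \<in> {1..m}" "u \<in> words m n" "w = i # u" by (auto simp: words_Suc)
  have "emeasure \<mu> (S i ` cube u) = ennreal (p i) * emeasure \<mu> (cube u)"
    using w by (intro emeasure_image_S cube_compact cube_subset)
  then have "prob (S i ` cube u) = p i * prob (cube u)"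
    using weight_pos [OF w(1)] by (simp add: emeasure_eq_measure ennreal_mult [symmetric])
  then show ?case using Suc.IH w by simp
qed

lemma prob_cube_pos:
  assumes "w \<in> words m n"
  shows "0 < prob (cube w)"
proof -
  have "set w \<subseteq> {1..m}" using assms by (simp add: words_def)
  then have "0 < prod_list (map p w)" by (induction w) (auto intro!: mult_pos_pos weight_pos)
  then show ?thesis by (simp add: prob_cube [OF assms])
qed

lemma small_cube:
  assumes "open U" "x \<in> U" "x \<in> K"
  shows "\<exists>n. \<exists>w\<in>words m n. x \<in> cube w \<and> cube w \<subseteq> U"
proof -
  obtain e where e: "0 < e" "ball x e \<subseteq> U" using assms open_contains_ball by blast
  have D: "0 \<le> diameter K" by (rule diameter_ge_0 [OF compact_imp_bounded [OF compact_K]])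
  obtain n where n: "max_ratio ^ n < e / (diameter K + 1)"
    using real_arch_pow_inv [of "e / (diameter K + 1)" max_ratio] max_ratio e D by auto
  then have "max_ratio ^ n * (diameter K + 1) < e" using D by (simp add: field_simps)
  then have "max_ratio ^ n * diameter K + max_ratio ^ n < e" by (simp add: algebra_simps)
  moreover have "0 < max_ratio ^ n" using max_ratio by simp
  ultimately have small: "max_ratio ^ n * diameter K < e" by linarith
  obtain w where w: "w \<in> words m n" "x \<in> cube w" using assms cubes_cover [of n] by blast
  have "y \<in> ball x e" if "y \<in> cube w" for y
    using cube_dist_le [OF w that] small by simp
  then show ?thesis using w e by blast
qed

text \<open>The parent of the cube of a word is obtained by deleting the last letter \<open>i\<close>, which divides the mass
  by \<open>p i\<close>.\<close>

sublocale nested_partitions \<mu> "\<lambda>n. cube ` words m n" K "Min (p ` {1..m})"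
proof
  show "A \<in> sets \<mu>" if "A \<in> cube ` words m n" for A n
    using that cube_compact by (auto intro!: borel_closed compact_imp_closed)
  show "\<exists>B\<in>cube ` words m n. A \<subseteq> B \<and> Min (p ` {1..m}) * prob B \<le> prob A"
    if A: "A \<in> cube ` words m (Suc n)" for A n
  proof -
    obtain u i where u: "A = cube (u @ [i])" "u @ [i] \<in> words m (Suc n)" "u \<in> words m n" "i \<in> {1..m}"
      using A by (metis imageE words_Suc_snoc)
    have "Min (p ` {1..m}) * prob (cube u) \<le> p i * prob (cube u)"
      using u(4) by (intro mult_right_mono Min_le) auto
    also have "\<dots> = prob A"
      using prob_cube [OF u(2)] prob_cube [OF u(3)] u(1) by (simp add: mult.commute)
    finally show ?thesis using u cube_snoc_subset by blast
  qed
  show "0 < Min (p ` {1..m})" using m_pos weight_pos by (subst Min_gr_iff) auto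
  show "\<exists>n. \<exists>A\<in>cube ` words m n. x \<in> A \<and> A \<subseteq> U" if "open U" "x \<in> U" "x \<in> K" for U x
    using small_cube [OF that] by blast
qed (use cubes_disjoint cubes_cover prob_cube_pos in \<open>auto simp: words_0 finite_words\<close>)

end

section \<open>The reverse maximal inequality\<close>

theorem proposition1p7:
  fixes m :: nat
    and r :: "nat \<Rightarrow> real"
    and R :: "nat \<Rightarrow> real ^ 'd \<Rightarrow> real ^ 'd"
    and b :: "nat \<Rightarrow> real ^ 'd"
    and S :: "nat \<Rightarrow> real ^ 'd \<Rightarrow> real ^ 'd"
    and K :: "(real ^ 'd) set"
    and p :: "nat \<Rightarrow> real"
    and \<mu> :: "(real ^ 'd) measure"
    and f :: "real ^ 'd \<Rightarrow> real"
  assumes "\<And>i. i \<in> {1..m} \<Longrightarrow> 0 < r i \<and> r i < 1"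
    and "\<And>i. i \<in> {1..m} \<Longrightarrow> orthogonal_transformation (R i)"
    and "\<And>i x. i \<in> {1..m} \<Longrightarrow> S i x = r i *\<^sub>R R i x + b i"
    and "\<not> (\<exists>x. \<forall>i\<in>{1..m}. S i x = x)"
    and "self_similar_set m S K"
    and "\<And>i. i \<in> {1..m} \<Longrightarrow> 0 < p i"
    and "(\<Sum>i\<in>{1..m}. p i) = 1"
    and "self_similar_measure m S p \<mu>"
    and "strong_separation m S K"
    and "set_integrable \<mu> K f"
    and "set_L1_ennreal \<mu> K (maximal_op m S K \<mu> f)"
  shows "set_integrable \<mu> K (\<lambda>x. \<bar>f x\<bar> * log_plus \<bar>f x\<bar>) \<and>
    (\<exists>C>0. (\<integral>\<^sup>+x\<in>K. ennreal (\<bar>f x\<bar> * log_plus \<bar>f x\<bar>) \<partial>\<mu>)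
             \<le> ennreal C * (\<integral>\<^sup>+x\<in>K. maximal_op m S K \<mu> f x \<partial>\<mu>))"
proof -
  interpret separated_self_similar m S K r p \<mu>
  proof
    show "dist (S i x) (S i y) = r i * dist x y" if "i \<in> {1..m}" for i x y
    proof -
      have "dist (S i x) (S i y) = norm (r i *\<^sub>R R i (x - y))"
        using assms(2) [OF that] assms(3) [OF that]
        by (simp add: dist_norm linear_diff orthogonal_transformation_linear scaleR_right_diff_distrib)
      then show ?thesis
        using assms(1,2) [OF that] by (simp add: orthogonal_transformation_norm dist_norm)
    qed
  qed (use assms in auto)
  \<comment> \<open>Extending \<open>\<bar>f\<bar>\<close> by zero turns all integrals over \<open>K\<close> into integrals over the whole space.\<close>
  define g where "g = (\<lambda>x. indicator K x * \<bar>f x\<bar>)"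
  interpret nested_partitions_function \<mu> "\<lambda>n. cube ` words m n" K "Min (p ` {1..m})" g
  proof
    show "integrable \<mu> g"
      using integrable_abs [OF assms(10) [unfolded set_integrable_def]]
      by (simp add: g_def abs_mult)
  qed (auto simp: g_def)
  let ?M = "maximal_op m S K \<mu> f"
  have maximal_le: "maximal x \<le> ?M x * indicator K x" for x
    unfolding maximal_def
  proof (rule SUP_least)
    fix n :: nat assume n: "n \<in> {1..}"
    show "ennreal (mean n x) \<le> ?M x * indicator K x"
    proof (cases "x \<in> K")
      case True
      then obtain w where w: "w \<in> words m n" "x \<in> cube w" using cubes_cover [of n] by blast
      have "ennreal (mean n x) = ennreal (\<integral>y. indicator (cube w) y * g y \<partial>\<mu>) / emeasure \<mu> (cube w)"
        using w mean_eq [of "cube w" n x] prob_cube_pos [OF w(1)]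
        by (simp add: cell_mean_def emeasure_eq_measure divide_ennreal integral_nonneg_AE g_nonneg)
      also have "ennreal (\<integral>y. indicator (cube w) y * g y \<partial>\<mu>)
          = (\<integral>\<^sup>+y. ennreal (indicator (cube w) y * g y) \<partial>\<mu>)"
        using w by (intro nn_integral_eq_integral [symmetric] integrable_cell) (auto simp: g_nonneg)
      also have "\<dots> = (\<integral>\<^sup>+y\<in>cube w. ennreal \<bar>f y\<bar> \<partial>\<mu>)"
        using cube_subset [OF w(1)]
        by (intro nn_integral_cong) (auto simp: g_def indicator_def)
      also have "\<dots> / emeasure \<mu> (cube w) \<le> ?M x"
        unfolding maximal_op_def using w n by (intro SUP_upper) auto
      finally show ?thesis using True by simp
    qed (simp add: mean_outside)
  qed
  define l where "l = max 1 ((\<integral>x. g x \<partial>\<mu>) / prob K)"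
  define C where "C = ln l + 1 / Min (p ` {1..m})"
  have "0 < C" using c_pos by (simp add: C_def l_def add_nonneg_pos)
  have g_log: "indicator K x * (\<bar>f x\<bar> * log_plus \<bar>f x\<bar>) = g x * log_plus (g x)" for x
    by (simp add: g_def indicator_def)
  have "(\<integral>\<^sup>+x. ennreal (g x * log_plus (g x)) \<partial>\<mu>) \<le> ennreal C * (\<integral>\<^sup>+x. maximal x \<partial>\<mu>)"
    unfolding C_def by (rule log_integral_le) (auto simp: l_def)
  also have "\<dots> \<le> ennreal C * (\<integral>\<^sup>+x\<in>K. ?M x \<partial>\<mu>)"
    by (intro mult_left_mono nn_integral_mono maximal_le) simp
  finally have bound: "(\<integral>\<^sup>+x. ennreal (g x * log_plus (g x)) \<partial>\<mu>) \<le> ennreal C * (\<integral>\<^sup>+x\<in>K. ?M x \<partial>\<mu>)" .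
  have "(\<integral>\<^sup>+x\<in>K. ?M x \<partial>\<mu>) < \<infinity>" using assms(11) by (simp add: set_L1_ennreal_def)
  then have "ennreal C * (\<integral>\<^sup>+x\<in>K. ?M x \<partial>\<mu>) < \<infinity>" by (simp add: ennreal_mult_less_top)
  with bound have finite: "(\<integral>\<^sup>+x. ennreal (g x * log_plus (g x)) \<partial>\<mu>) < \<infinity>" by (rule le_less_trans)
  have "integrable \<mu> (\<lambda>x. g x * log_plus (g x))"
  proof (rule integrableI_nonneg)
    show "(\<lambda>x. g x * log_plus (g x)) \<in> borel_measurable \<mu>"
      unfolding log_plus_def by measurable
    show "AE x in \<mu>. 0 \<le> g x * log_plus (g x)" by (simp add: log_plus_def g_nonneg)
  qed (rule finite)
  then have "set_integrable \<mu> K (\<lambda>x. \<bar>f x\<bar> * log_plus \<bar>f x\<bar>)"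
    by (simp add: set_integrable_def g_log)
  moreover have "(\<integral>\<^sup>+x\<in>K. ennreal (\<bar>f x\<bar> * log_plus \<bar>f x\<bar>) \<partial>\<mu>)
      = (\<integral>\<^sup>+x. ennreal (g x * log_plus (g x)) \<partial>\<mu>)"
    by (intro nn_integral_cong) (simp add: g_def indicator_def)
  ultimately show ?thesis using bound \<open>0 < C\<close> by auto
qed

end
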